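(* Let $p$ be a northeast lattice path from $(0,0)$ to $(n,m)$, with height sequence $(p_1, p_2, \dots, p_n)$, and let $v = (v_1, \dots, v_n) = \Delta p = (p_1, p_2 - p_1, \dots, p_n - p_{n-1})$. The number $\mathrm{LP}(p)$ of northeast lattice paths restricted by $p$ is \[ \mathrm{LP}(p) = \sum_x \prod_{i=1}^n \binom{v_{n+1-i} + x_i - 1}{x_i}, \] where the sum is over all $C_{n+1}$ lattice points $x = (x_1, \dots, x_n)$ in $\Pi_n((1, 1, \dots, 1, 1))$.
   Context: A northeast lattice path from $(0,0)$ to $(n,m)$ is a sequence of points of $\mathbb{Z}^2$ starting at $(0,0)$ and ending at $(n,m)$ made in steps $E = \langle 1,0\rangle$ and $N = \langle 0,1\rangle$. Such a path $q$ is represented by the sequence of heights $(q_1, q_2, \dots, q_n)$, where $q_i$ is the height ($y$-coordinate) of the path along the interval from $x = i-1$ to $x = i$; this is a nondecreasing tuple of integers with $0 \le q_1 \le \dots \le q_n \le m$, and it determines the path uniquely (given the endpoint). A northeast lattice path $q$ from $(0,0)$ to $(n,m)$ is restricted by $p$ if no part of $q$ lies directly above $p$, i.e., $q_i \le p_i$ for all $1 \le i \le n$. $\mathrm{LP}(p)$ is the number of northeast lattice paths restricted by $p$; equivalently, it is the number of nondecreasing tuples $(q_1,\dots,q_n)$ of nonnegative integers with $q_i \le p_i$ for all $i$. For a tuple $x = (x_1,\dots,x_n)$, write $\Sigma x = (x_1, x_1 + x_2, \dots, x_1 + x_2 + \dots + x_n)$ for its sequence of partial sums. For a tuple $v = (v_1,\dots,v_n)$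 of nonnegative integers, the Pitman--Stanley polytope is \[ \Pi_n(v) = \{ x \in \mathbb{R}_{\ge 0}^n : \Sigma x \le \Sigma v \text{ componentwise} \}. \] A lattice point in $\Pi_n(v)$ is a point of $\Pi_n(v)$ with integer coordinates. Thus the lattice points in $\Pi_n((1,1,\dots,1))$ are the tuples of nonnegative integers $x$ with $x_1 + \dots + x_i \le i$ for all $1 \le i \le n$. $C_n = \binom{2n}{n}/(n+1)$ denotes the $n$th Catalan number. Binomial coefficients are generalized: $\binom{a}{k} = a(a-1)\cdots(a-k+1)/k!$ for integers $a$ and $k \ge 0$; in particular $\binom{x-1}{x}$ equals $1$ if $x = 0$ and $0$ if $x \ge 1$. *)

theory Defs
  imports Complex_Main "HOL-Library.FuncSet" "HOL-Library.Product_Plus"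
begin

text \<open>
  Tuples \<open>(x\<^sub>1, \<dots>, x\<^sub>n)\<close> are functions on \<open>nat\<close> used at the indices \<open>1, \<dots>, n\<close> only; where sets of
  tuples are formed, the functions are taken extensional on \<open>{1..n}\<close>, so that each tuple is
  represented exactly once.
\<close>

definition ne_path :: "nat \<Rightarrow> nat \<Rightarrow> (int \<times> int) list \<Rightarrow> bool" where
  "ne_path n m q \<longleftrightarrow> q \<noteq> [] \<and> hd q = (0, 0) \<and> last q = (int n, int m) \<and>
     (\<forall>k. Suc k < length q \<longrightarrow> q ! Suc k = q ! k + (1, 0) \<or> q ! Suc k = q ! k + (0, 1))"

text \<open>
  A path to \<open>(n, m)\<close> has exactly one east step from \<open>x = i - 1\<close> to \<open>x = i\<close> for each
  \<open>1 \<le> i \<le> n\<close>; the value is meaningful only for such \<open>i\<close>.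
\<close>

definition height :: "(int \<times> int) list \<Rightarrow> nat \<Rightarrow> int" where
  "height q i = (THE y. \<exists>k. Suc k < length q \<and> q ! k = (int i - 1, y) \<and> q ! Suc k = (int i, y))"

definition restricted_by :: "nat \<Rightarrow> (int \<times> int) list \<Rightarrow> (int \<times> int) list \<Rightarrow> bool" where
  "restricted_by n p q \<longleftrightarrow> (\<forall>i\<in>{1..n}. height q i \<le> height p i)"

definition LP :: "nat \<Rightarrow> nat \<Rightarrow> (int \<times> int) list \<Rightarrow> nat" where
  "LP n m p = card {q. ne_path n m q \<and> restricted_by n p q}"

definition differences :: "(nat \<Rightarrow> int) \<Rightarrow> nat \<Rightarrow> int" where
  "differences h i = (if i = 1 then h 1 else h i - h (i - 1))"

definition partial_sums :: "(nat \<Rightarrow> 'a::comm_monoid_add) \<Rightarrow> nat \<Rightarrow> 'a" where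
  "partial_sums x i = (\<Sum>j=1..i. x j)"

definition pitman_stanley :: "nat \<Rightarrow> (nat \<Rightarrow> nat) \<Rightarrow> (nat \<Rightarrow> real) set" where
  "pitman_stanley n v =
     {x \<in> {1..n} \<rightarrow>\<^sub>E {0..}. \<forall>i\<in>{1..n}. partial_sums x i \<le> real (partial_sums v i)}"

definition lattice_points :: "nat \<Rightarrow> (nat \<Rightarrow> real) set \<Rightarrow> (nat \<Rightarrow> real) set" where
  "lattice_points n P = {x \<in> P. \<forall>i\<in>{1..n}. x i \<in> \<int>}"

definition catalan :: "nat \<Rightarrow> real" where
  "catalan n = real ((2 * n) choose n) / real (n + 1)"

end

theory Submission
  imports Defs
begin

text \<open>
  Split a restricted path at the height \<open>p\<^sub>n\<^sub>-\<^sub>1\<close>: if its last \<open>x\<close> east steps lie strictly above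
  \<open>p\<^sub>n\<^sub>-\<^sub>1\<close>, then their heights form an arbitrary multiset of size \<open>x\<close> of the \<open>v\<^sub>n\<close> heights between
  \<open>p\<^sub>n\<^sub>-\<^sub>1 + 1\<close> and \<open>p\<^sub>n\<close>, and the remaining steps form a path bounded by \<open>p\<^sub>1, \<dots>, p\<^sub>n\<^sub>-\<^sub>1\<close>, with
  possibly one more step, also bounded by \<open>p\<^sub>n\<^sub>-\<^sub>1\<close>. To iterate this, let \<open>G n k\<close> count the paths with \<open>n + k\<close>
  east steps that end at height \<open>p\<^sub>n\<close>, the first \<open>n\<close> steps being restricted by \<open>p\<close> and the last \<open>k\<close>
  only by the end point. The same splitting gives
  \<open>G (n + 1) k = (\<Sum>x\<le>k + 1. multichoose v\<^sub>n\<^sub>+\<^sub>1 x * G n (k + 1 - x))\<close> and \<open>G 0 k = 1\<close>.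

  Unfolding this recurrence chooses \<open>x\<close> for column \<open>n\<close> first, then for column \<open>n - 1\<close>, and so on; each
  column adds one unit of slack and uses up \<open>x\<close> of it. The admissible sequences of choices are therefore
  the lattice points of the Pitman--Stanley polytope, and \<open>G n 0\<close> is the desired number of paths. The
  summation over the polytope obeys the same recurrence (lemma \<open>sum_slack_points_Suc\<close>), whence
  lemma \<open>path_count_eq_sum\<close>. With all factors equal to \<open>1\<close>, the recurrence counts the lattice points
  themselves, and the solution consists of ballot numbers (lemma \<open>card_slack_points\<close>).

  The splitting needs no bijection. Removing the last step of a path gives the Pascal recurrence
  \<open>g (k + 1) (c + 1) = g (k + 1) c + g k (c + 1)\<close> for the number \<open>g k c\<close> of paths that end \<open>k\<close> columns
  to the right of the restricted ones at height \<open>c \<ge> p\<^sub>n\<close>, and iterating it from height \<open>p\<^sub>n\<close>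
  to height \<open>p\<^sub>n\<^sub>+\<^sub>1\<close> produces the multiset coefficients (lemma \<open>pascal_convolution\<close>).
\<close>


section \<open>Lattice paths and their heights\<close>

lemma ne_path_origin: "ne_path 0 0 [(0, 0)]"
  by (simp add: ne_path_def)

lemma ne_path_snoc:
  assumes "ne_path n m q" "z = (int n', int m')" "z = (int n, int m) + (1, 0) \<or> z = (int n, int m) + (0, 1)"
  shows "ne_path n' m' (q @ [z])"
proof -
  have q: "q \<noteq> []" "last q = (int n, int m)"
    using assms(1) by (auto simp: ne_path_def)
  have "(q @ [z]) ! Suc k = (q @ [z]) ! k + (1, 0) \<or> (q @ [z]) ! Suc k = (q @ [z]) ! k + (0, 1)"
    if k: "Suc k < length (q @ [z])" for k
  proof (cases "Suc k < length q")
    case True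
    then show ?thesis using assms(1) by (auto simp: ne_path_def nth_append)
  next
    case False
    then have "k = length q - 1" "Suc k = length q" using k by auto
    then have "(q @ [z]) ! k = last q" "(q @ [z]) ! Suc k = z"
      using q(1) by (auto simp: nth_append last_conv_nth)
    then show ?thesis using assms(3) q(2) by simp
  qed
  then show ?thesis using assms(1,2) q by (simp add: ne_path_def)
qed

lemma ne_path_east: "ne_path n m q \<Longrightarrow> ne_path (Suc n) m (q @ [(int (Suc n), int m)])"
  by (erule ne_path_snoc) auto

lemma ne_path_north: "ne_path n m q \<Longrightarrow> ne_path n (Suc m) (q @ [(int n, int (Suc m))])"
  by (erule ne_path_snoc) auto

text \<open>
  End points of paths are pairs of natural numbers; this is what lets a path without its last
  step be recognised as a path again.
\<close>

lemma steps_last_nat: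
  assumes "q \<noteq> []" "hd q = (0, 0)"
    "\<forall>k. Suc k < length q \<longrightarrow> q ! Suc k = q ! k + (1, 0) \<or> q ! Suc k = q ! k + (0, 1 :: int)"
  shows "\<exists>n m. last q = (int n, int m)"
  using assms
proof (induction q rule: rev_nonempty_induct)
  case (single x)
  then show ?case by (intro exI[of _ 0]) simp
next
  case (snoc z q)
  have "\<forall>k. Suc k < length q \<longrightarrow> q ! Suc k = q ! k + (1, 0) \<or> q ! Suc k = q ! k + (0, 1)"
    using snoc.prems(2) by (auto simp: nth_append split: if_splits)
  then obtain n m where nm: "last q = (int n, int m)"
    using snoc.IH snoc.prems(1) snoc.hyps by auto
  have "z = last q + (1, 0) \<or> z = last q + (0, 1)"
    using snoc.prems(2)[rule_format, of "length q - 1"] snoc.hyps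
    by (auto simp: nth_append last_conv_nth)
  then have "z = (int (Suc n), int m) \<or> z = (int n, int (Suc m))"
    using nm by auto
  then show ?case by (auto simp del: of_nat_Suc)
qed

lemma ne_path_cases:
  assumes "ne_path n m q"
  obtains (origin) "n = 0" "m = 0" "q = [(0, 0)]"
  | (east) n' q' where "n = Suc n'" "ne_path n' m q'" "q = q' @ [(int n, int m)]"
  | (north) m' q' where "m = Suc m'" "ne_path n m' q'" "q = q' @ [(int n, int m)]"
proof -
  have q: "q \<noteq> []" "hd q = (0, 0)" "last q = (int n, int m)"
    and steps: "\<forall>k. Suc k < length q \<longrightarrow> q ! Suc k = q ! k + (1, 0) \<or> q ! Suc k = q ! k + (0, 1)"
    using assms by (auto simp: ne_path_def)
  obtain q' where q': "q = q' @ [(int n, int m)]"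
    using q by (metis append_butlast_last_id)
  show thesis
  proof (cases "q' = []")
    case True
    then show thesis using q q' origin by simp
  next
    case False
    have hd: "hd q' = (0, 0)" using q q' False by simp
    have st: "\<forall>k. Suc k < length q' \<longrightarrow> q' ! Suc k = q' ! k + (1, 0) \<or> q' ! Suc k = q' ! k + (0, 1)"
      using steps unfolding q' by (auto simp: nth_append split: if_splits)
    obtain a b where ab: "last q' = (int a, int b)"
      using steps_last_nat[OF False hd st] by auto
    have path: "ne_path a b q'"
      using False hd st ab by (simp add: ne_path_def)
    have "(int n, int m) = last q' + (1, 0) \<or> (int n, int m) = last q' + (0, 1)"
      using steps[rule_format, of "length q' - 1"] False
      by (auto simp: q' nth_append last_conv_nth)
    then have "n = Suc a \<and> m = b \<or> n = a \<and> m = Suc b"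
      using ab by auto
    then show thesis using path q' east north by blast
  qed
qed

lemma ne_path_induct [consumes 1, case_names origin east north]:
  assumes "ne_path n m q"
    and "P 0 0 [(0, 0)]"
    and "\<And>n m q. ne_path n m q \<Longrightarrow> P n m q \<Longrightarrow> P (Suc n) m (q @ [(int (Suc n), int m)])"
    and "\<And>n m q. ne_path n m q \<Longrightarrow> P n m q \<Longrightarrow> P n (Suc m) (q @ [(int n, int (Suc m))])"
  shows "P n m q"
  using assms(1)
proof (induction "n + m" arbitrary: n m q rule: less_induct)
  case less
  from less.prems show ?case
  proof (cases rule: ne_path_cases)
    case origin
    then show ?thesis using assms(2) by simp
  next
    case (east n' q')
    then show ?thesis using assms(3) less.hyps by simp
  next
    case (north m' q')
    then show ?thesis using assms(4) less.hyps by simp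
  qed
qed

text \<open>
  The defining property of the definite description in \<^const>\<open>height\<close>; as a relation
  it can be followed along a path before its unique solvability is known.
\<close>

definition east_step :: "(int \<times> int) list \<Rightarrow> nat \<Rightarrow> int \<Rightarrow> bool" where
  "east_step q i y \<longleftrightarrow> (\<exists>k. Suc k < length q \<and> q ! k = (int i - 1, y) \<and> q ! Suc k = (int i, y))"

lemma height_eq_The: "height q i = (THE y. east_step q i y)"
  by (simp add: height_def east_step_def)

lemma east_step_singleton: "\<not> east_step [z] i y"
  by (simp add: east_step_def)

lemma east_step_snoc:
  assumes "q \<noteq> []"
  shows "east_step (q @ [z]) i y \<longleftrightarrow> east_step q i y \<or> (last q = (int i - 1, y) \<and> z = (int i, y))"
    (is "?L \<longleftrightarrow> ?R")
proof
  assume ?L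
  then obtain k where k: "Suc k < length (q @ [z])" "(q @ [z]) ! k = (int i - 1, y)"
      "(q @ [z]) ! Suc k = (int i, y)"
    by (auto simp: east_step_def)
  show ?R
  proof (cases "Suc k < length q")
    case True
    then show ?thesis using k by (auto simp: east_step_def nth_append)
  next
    case False
    then have "k = length q - 1" "Suc k = length q" using k(1) by auto
    then show ?thesis using k assms by (auto simp: nth_append last_conv_nth)
  qed
next
  assume ?R
  then show ?L
  proof
    assume "east_step q i y"
    then obtain k where "Suc k < length q" "q ! k = (int i - 1, y)" "q ! Suc k = (int i, y)"
      by (auto simp: east_step_def)
    then show ?L unfolding east_step_def by (intro exI[of _ k]) (auto simp: nth_append)
  next
    assume "last q = (int i - 1, y) \<and> z = (int i, y)"
    then show ?L unfolding east_step_def using assms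
      by (intro exI[of _ "length q - 1"]) (auto simp: nth_append last_conv_nth)
  qed
qed

lemma ne_path_last: "ne_path n m q \<Longrightarrow> q \<noteq> [] \<and> last q = (int n, int m)"
  by (simp add: ne_path_def)

lemma east_step_north:
  "ne_path n m q \<Longrightarrow> east_step (q @ [(int n, int (Suc m))]) i y \<longleftrightarrow> east_step q i y"
  using ne_path_last[of n m q] by (subst east_step_snoc) auto

lemma east_step_east:
  "ne_path n m q \<Longrightarrow> east_step (q @ [(int (Suc n), int m)]) i y \<longleftrightarrow>
     east_step q i y \<or> (i = Suc n \<and> y = int m)"
  using ne_path_last[of n m q] by (subst east_step_snoc) auto

lemma east_step_range:
  "ne_path n m q \<Longrightarrow> east_step q i y \<Longrightarrow> i \<in> {1..n} \<and> 0 \<le> y \<and> y \<le> int m"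
proof (induction arbitrary: i y rule: ne_path_induct)
  case origin
  then show ?case by (simp add: east_step_singleton)
next
  case (east n m q)
  then show ?case by (fastforce simp: east_step_east simp del: of_nat_Suc)
next
  case (north n m q)
  then show ?case by (fastforce simp: east_step_north simp del: of_nat_Suc)
qed

lemma height_north:
  "ne_path n m q \<Longrightarrow> height (q @ [(int n, int (Suc m))]) i = height q i"
  by (simp add: height_eq_The east_step_north del: of_nat_Suc)

lemma height_east_old:
  "ne_path n m q \<Longrightarrow> i \<le> n \<Longrightarrow> height (q @ [(int (Suc n), int m)]) i = height q i"
  by (simp add: height_eq_The east_step_east del: of_nat_Suc)

lemma height_east_new:
  "ne_path n m q \<Longrightarrow> height (q @ [(int (Suc n), int m)]) (Suc n) = int m"
  using east_step_range[of n m q "Suc n"]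
  by (auto simp: height_eq_The east_step_east simp del: of_nat_Suc)

lemma height_range:
  "ne_path n m q \<Longrightarrow> i \<in> {1..n} \<Longrightarrow> 0 \<le> height q i \<and> height q i \<le> int m"
proof (induction rule: ne_path_induct)
  case (east n m q)
  then show ?case
    by (cases "i = Suc n") (auto simp: height_east_old height_east_new simp del: of_nat_Suc)
next
  case (north n m q)
  then show ?case by (auto simp: height_north simp del: of_nat_Suc)
qed simp

lemma height_mono:
  "ne_path n m q \<Longrightarrow> 1 \<le> i \<Longrightarrow> Suc i \<le> n \<Longrightarrow> height q i \<le> height q (Suc i)"
proof (induction rule: ne_path_induct)
  case (east n m q)
  then show ?case using height_range[of n m q i]
    by (cases "Suc i = Suc n") (auto simp: height_east_old height_east_new simp del: of_nat_Suc)
qed (auto simp: height_north simp del: of_nat_Suc)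


section \<open>Counting paths with constrained east steps\<close>

text \<open>
  Recursion on the last step of a path to \<open>(n, m)\<close>. Which heights the east step in a column may
  have is given by a predicate rather than a bound because the argument below also counts paths
  whose last columns are unconstrained.
\<close>

fun path_count :: "(nat \<Rightarrow> nat \<Rightarrow> bool) \<Rightarrow> nat \<Rightarrow> nat \<Rightarrow> nat" where
  "path_count B 0 m = 1"
| "path_count B (Suc n) 0 = (if B (Suc n) 0 then path_count B n 0 else 0)"
| "path_count B (Suc n) (Suc m) =
     path_count B (Suc n) m + (if B (Suc n) (Suc m) then path_count B n (Suc m) else 0)"

definition admissible_paths :: "(nat \<Rightarrow> nat \<Rightarrow> bool) \<Rightarrow> nat \<Rightarrow> nat \<Rightarrow> (int \<times> int) list set" where
  "admissible_paths B n m = {q. ne_path n m q \<and> (\<forall>i\<in>{1..n}. B i (nat (height q i)))}"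

lemma admissible_east:
  "ne_path n m q \<Longrightarrow> q @ [(int (Suc n), int m)] \<in> admissible_paths B (Suc n) m \<longleftrightarrow>
     q \<in> admissible_paths B n m \<and> B (Suc n) m"
  by (auto simp: admissible_paths_def ne_path_east height_east_old height_east_new
        atLeastAtMostSuc_conv simp del: of_nat_Suc)

lemma admissible_north:
  "ne_path n m q \<Longrightarrow> q @ [(int n, int (Suc m))] \<in> admissible_paths B n (Suc m) \<longleftrightarrow>
     q \<in> admissible_paths B n m"
  by (auto simp: admissible_paths_def ne_path_north height_north simp del: of_nat_Suc)

lemma admissible_ne_path: "q \<in> admissible_paths B n m \<Longrightarrow> ne_path n m q"
  by (simp add: admissible_paths_def)

lemma admissible_cases:
  assumes "q \<in> admissible_paths B n m"
  obtains (origin) "n = 0" "m = 0" "q = [(0, 0)]"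
  | (east) n' q' where "n = Suc n'" "q' \<in> admissible_paths B n' m" "B n m"
      "q = q' @ [(int n, int m)]"
  | (north) m' q' where "m = Suc m'" "q' \<in> admissible_paths B n m'" "q = q' @ [(int n, int m)]"
  using admissible_ne_path[OF assms]
proof (cases rule: ne_path_cases)
  case (east n' q')
  then show ?thesis using that(2) assms admissible_east by blast
next
  case (north m' q')
  then show ?thesis using that(3) assms admissible_north by blast
qed (rule that(1))

lemma admissible_paths_00: "admissible_paths B 0 0 = {[(0, 0)]}"
  by (auto simp: admissible_paths_def ne_path_origin elim: ne_path_cases)

lemma admissible_paths_0_Suc:
  "admissible_paths B 0 (Suc m) = (\<lambda>q. q @ [(int 0, int (Suc m))]) ` admissible_paths B 0 m"
  using admissible_north[OF admissible_ne_path] by (blast elim: admissible_cases)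

lemma admissible_paths_Suc_0:
  "admissible_paths B (Suc n) 0 =
     (if B (Suc n) 0 then (\<lambda>q. q @ [(int (Suc n), int 0)]) ` admissible_paths B n 0 else {})"
  (is "?L = ?R")
proof (intro equalityI subsetI)
  fix q assume "q \<in> ?L"
  then show "q \<in> ?R"
    by (cases rule: admissible_cases) (simp_all del: of_nat_Suc of_nat_0)
next
  fix q assume "q \<in> ?R"
  then obtain q' where q': "q' \<in> admissible_paths B n 0" "B (Suc n) 0"
      "q = q' @ [(int (Suc n), int 0)]"
    by (auto simp del: of_nat_Suc of_nat_0 split: if_splits)
  then show "q \<in> ?L" using admissible_east[OF admissible_ne_path[OF q'(1)]] by blast
qed

lemma admissible_paths_Suc_Suc:
  "admissible_paths B (Suc n) (Suc m) =
     (\<lambda>q. q @ [(int (Suc n), int (Suc m))]) ` admissible_paths B (Suc n) m \<union>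
     (if B (Suc n) (Suc m)
      then (\<lambda>q. q @ [(int (Suc n), int (Suc m))]) ` admissible_paths B n (Suc m) else {})"
  (is "?L = ?N \<union> ?E")
proof (intro equalityI subsetI)
  fix q assume "q \<in> ?L"
  then show "q \<in> ?N \<union> ?E"
    by (cases rule: admissible_cases) (simp_all del: of_nat_Suc)
next
  fix q assume "q \<in> ?N \<union> ?E"
  then show "q \<in> ?L"
  proof
    assume "q \<in> ?N"
    then show ?thesis using admissible_north[OF admissible_ne_path] by blast
  next
    assume "q \<in> ?E"
    then obtain q' where q': "q' \<in> admissible_paths B n (Suc m)" "B (Suc n) (Suc m)"
        "q = q' @ [(int (Suc n), int (Suc m))]"
      by (auto simp del: of_nat_Suc split: if_splits)
    then show ?thesis using admissible_east[OF admissible_ne_path[OF q'(1)]] by blast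
  qed
qed

lemma admissible_disjoint:
  "(\<lambda>q. q @ [z]) ` admissible_paths B (Suc n) m \<inter> (\<lambda>q. q @ [z]) ` admissible_paths B' n (Suc m) = {}"
  by (auto dest!: admissible_ne_path ne_path_last)

lemma inj_on_snoc: "inj_on (\<lambda>q. q @ [z]) A"
  by (simp add: inj_on_def)

lemma card_admissible_paths:
  "finite (admissible_paths B n m) \<and> card (admissible_paths B n m) = path_count B n m"
proof (induction B n m rule: path_count.induct)
  case (1 B m)
  show ?case
    by (induction m)
      (auto simp: admissible_paths_00 admissible_paths_0_Suc card_image inj_on_snoc)
next
  case (2 B n)
  then show ?case by (auto simp: admissible_paths_Suc_0 card_image inj_on_snoc)
next
  case (3 B n m)
  then show ?case
    by (auto simp: admissible_paths_Suc_Suc card_image inj_on_snoc card_Un_disjoint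
        admissible_disjoint simp del: of_nat_Suc)
qed

lemma path_count_cong:
  "(\<And>i y. 1 \<le> i \<Longrightarrow> i \<le> n \<Longrightarrow> y \<le> m \<Longrightarrow> B i y = B' i y) \<Longrightarrow> path_count B n m = path_count B' n m"
  by (induction B n m rule: path_count.induct) auto


section \<open>The recurrence in the number of constrained columns\<close>

text \<open>
  The truncated subtraction is harmless: it matters only for \<open>w = x = 0\<close>, where the value is
  \<open>0 choose 0 = 1\<close>, in agreement with the generalised binomial coefficient.
\<close>

definition multichoose :: "nat \<Rightarrow> nat \<Rightarrow> nat" where
  "multichoose w x = (w + x - 1) choose x"

lemma multichoose_0_right [simp]: "multichoose w 0 = 1"
  by (simp add: multichoose_def)

lemma multichoose_Suc_Suc:
  "multichoose (Suc w) (Suc x) = multichoose w (Suc x) + multichoose (Suc w) x"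
  by (simp add: multichoose_def)

lemma multichoose_gchoose:
  "real (multichoose w x) = (real w + real x - 1) gchoose x"
proof (cases "w + x = 0")
  case False
  then have "real (w + x - 1) = real w + real x - 1"
    by (subst of_nat_diff) auto
  then show ?thesis by (simp only: multichoose_def binomial_gbinomial)
qed (simp add: multichoose_def)

text \<open>
  If \<open>g k b\<close> is the number of paths ending \<open>k\<close> columns further right at height \<open>b\<close>, then the
  \<open>x\<close>-th summand counts the paths to height \<open>b + w\<close> of which exactly \<open>x\<close> steps are above \<open>b\<close>.
  It follows from the Pascal recurrence, since the multiset coefficients satisfy it too; the values
  at \<open>k = 0\<close> are constant because without a free column only north steps can lead further up.
\<close>

lemma pascal_convolution:
  fixes g :: "nat \<Rightarrow> nat \<Rightarrow> nat"
  assumes const: "\<And>c. b \<le> c \<Longrightarrow> g 0 (Suc c) = g 0 c"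
    and pascal: "\<And>k c. b \<le> c \<Longrightarrow> g (Suc k) (Suc c) = g (Suc k) c + g k (Suc c)"
  shows "g k (b + w) = (\<Sum>x\<le>k. multichoose w x * g (k - x) b)"
proof (induction w arbitrary: k)
  case 0
  have "(\<Sum>x\<le>k. multichoose 0 x * g (k - x) b) = (\<Sum>x\<in>{0}. multichoose 0 x * g (k - x) b)"
    by (rule sum.mono_neutral_right) (auto simp: multichoose_def)
  then show ?case by simp
next
  case (Suc w)
  note IH = Suc.IH
  show ?case
  proof (induction k)
    case 0
    then show ?case using IH[of 0] const[of "b + w"] by simp
  next
    case (Suc k)
    have "g (Suc k) (b + Suc w) = g (Suc k) (b + w) + g k (b + Suc w)"
      using pascal[of "b + w" k] by simp
    also have "\<dots> = (\<Sum>x\<le>Suc k. multichoose (Suc w) x * g (Suc k - x) b)"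
      unfolding IH Suc.IH sum.atMost_Suc_shift
      by (simp add: multichoose_Suc_Suc sum.distrib algebra_simps del: sum.atMost_Suc)
    finally show ?case .
  qed
qed

definition capped :: "(nat \<Rightarrow> nat) \<Rightarrow> nat \<Rightarrow> nat \<Rightarrow> nat \<Rightarrow> bool" where
  "capped h n i y \<longleftrightarrow> (i \<le> n \<longrightarrow> y \<le> h i)"

text \<open>Above the cap of the last column only north steps remain.\<close>

lemma path_count_capped_const:
  assumes "h 0 = 0" "h n \<le> c"
  shows "path_count (capped h n) n (Suc c) = path_count (capped h n) n c"
  using assms by (cases n) (auto simp: capped_def)

lemma path_count_capped_const_ge:
  assumes "h 0 = 0" "h n \<le> c"
  shows "path_count (capped h n) n c = path_count (capped h n) n (h n)"
  using assms(2) by (induction rule: dec_induct) (simp_all add: assms(1) path_count_capped_const)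

lemma path_count_axis: "path_count (capped h 0) k 0 = 1"
  by (induction k) (auto simp: capped_def)

text \<open>
  At end height \<open>h (Suc n)\<close> the cap on column \<open>Suc n\<close> is implied by the end point, so that this
  column joins the unconstrained ones. The remaining caps concern columns up to \<open>n\<close> only, so Pascal's
  recurrence for the free columns leads from end height \<open>h n\<close> to end height \<open>h (Suc n)\<close>.
\<close>

lemma path_count_capped_rec:
  assumes "h 0 = 0" "h n \<le> h (Suc n)"
  shows "path_count (capped h (Suc n)) (Suc n + k) (h (Suc n)) =
    (\<Sum>x\<le>Suc k. multichoose (h (Suc n) - h n) x *
       path_count (capped h n) (n + (Suc k - x)) (h n))"
proof -
  have "path_count (capped h (Suc n)) (Suc n + k) (h (Suc n)) =
      path_count (capped h n) (n + Suc k) (h n + (h (Suc n) - h n))"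
    using assms(2) by (auto intro!: path_count_cong simp: capped_def le_Suc_eq)
  also have "\<dots> = (\<Sum>x\<le>Suc k. multichoose (h (Suc n) - h n) x *
       path_count (capped h n) (n + (Suc k - x)) (h n))"
    by (rule pascal_convolution[where g = "\<lambda>k. path_count (capped h n) (n + k)"])
      (auto simp: assms(1) path_count_capped_const, simp add: capped_def)
  finally show ?thesis .
qed


section \<open>Sums over lattice points\<close>

text \<open>
  For \<open>k = 0\<close> these are the lattice points of the Pitman--Stanley polytope of \<open>(1, \<dots>, 1)\<close> with
  the order of coordinates reversed; a general \<open>k\<close> replaces \<open>(1, \<dots>, 1)\<close> by \<open>(k + 1, 1, \<dots>, 1)\<close>.
  Because of the reversal, coordinate \<open>i\<close> belongs to column \<open>i\<close> of the path, and the coordinate chosen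
  first by the recurrence is the last one, so that it can be removed without shifting indices.
\<close>

definition slack_points :: "nat \<Rightarrow> nat \<Rightarrow> (nat \<Rightarrow> nat) set" where
  "slack_points n k =
     {y \<in> {1..n} \<rightarrow>\<^sub>E UNIV. \<forall>i\<in>{1..n}. (\<Sum>j=i..n. y j) \<le> n + 1 - i + k}"

lemma slack_points_0: "slack_points 0 k = {\<lambda>_. undefined}"
  by (simp add: slack_points_def)

lemma slack_points_tail:
  "y \<in> slack_points n k \<Longrightarrow> i \<in> {1..n} \<Longrightarrow> (\<Sum>j=i..n. y j) \<le> n + 1 - i + k"
  by (simp add: slack_points_def)

lemma finite_slack_points: "finite (slack_points n k)"
proof (rule finite_subset)
  show "slack_points n k \<subseteq> {1..n} \<rightarrow>\<^sub>E {..n + k}"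
  proof (intro subsetI PiE_I)
    fix y i assume y: "y \<in> slack_points n k" and i: "i \<in> {1..n}"
    have "y i \<le> (\<Sum>j=i..n. y j)" using i by (intro member_le_sum) auto
    also have "\<dots> \<le> n + 1 - i + k" using y i by (auto simp: slack_points_def)
    also have "\<dots> \<le> n + k" using i by auto
    finally show "y i \<in> {..n + k}" by simp
  qed (auto simp: slack_points_def PiE_def extensional_def)
  show "finite ({1..n} \<rightarrow>\<^sub>E {..n + k})" by (simp add: finite_PiE)
qed

lemma slack_points_Suc_iff:
  assumes "y \<in> {1..n} \<rightarrow>\<^sub>E UNIV"
  shows "y(Suc n := x) \<in> slack_points (Suc n) k \<longleftrightarrow>
    x \<le> Suc k \<and> y \<in> slack_points n (Suc k - x)"
proof -
  have tail: "(\<Sum>j=i..Suc n. (y(Suc n := x)) j) = (\<Sum>j=i..n. y j) + x" if "i \<le> Suc n" for i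
    using that by simp
  have ext: "y(Suc n := x) \<in> {1..Suc n} \<rightarrow>\<^sub>E UNIV"
    using assms by (auto simp: PiE_def extensional_def)
  have "y(Suc n := x) \<in> slack_points (Suc n) k \<longleftrightarrow>
      (\<forall>i\<in>{1..Suc n}. (\<Sum>j=i..n. y j) + x \<le> Suc n + 1 - i + k)"
    using ext tail by (simp add: slack_points_def)
  also have "\<dots> \<longleftrightarrow> x \<le> Suc k \<and> (\<forall>i\<in>{1..n}. (\<Sum>j=i..n. y j) + x \<le> Suc n + 1 - i + k)"
    by (auto simp: atLeastAtMostSuc_conv)
  also have "\<dots> \<longleftrightarrow> x \<le> Suc k \<and> (\<forall>i\<in>{1..n}. (\<Sum>j=i..n. y j) \<le> n + 1 - i + (Suc k - x))"
  proof (rule conj_cong[OF refl], rule ball_cong[OF refl])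
    fix i assume "x \<le> Suc k" "i \<in> {1..n}"
    then show "((\<Sum>j=i..n. y j) + x \<le> Suc n + 1 - i + k) =
        ((\<Sum>j=i..n. y j) \<le> n + 1 - i + (Suc k - x))"
      by auto
  qed
  finally show ?thesis using assms by (simp add: slack_points_def)
qed

text \<open>
  Splitting off the last coordinate \<open>x\<close> leaves a point whose tail sums are bounded with the
  slack \<open>k + 1 - x\<close> in place of \<open>k\<close>. The weights are arbitrary, since the same recurrence is used for
  counting the points.
\<close>

lemma sum_slack_points_Suc:
  fixes f :: "nat \<Rightarrow> nat \<Rightarrow> 'a :: comm_semiring_1"
  shows "(\<Sum>y\<in>slack_points (Suc n) k. \<Prod>i=1..Suc n. f i (y i)) =
    (\<Sum>x\<le>Suc k. f (Suc n) x * (\<Sum>y\<in>slack_points n (Suc k - x). \<Prod>i=1..n. f i (y i)))"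
proof -
  have ext: "y \<in> {1..n} \<rightarrow>\<^sub>E UNIV" if "y \<in> slack_points n l" for y :: "nat \<Rightarrow> nat" and l
    using that by (simp add: slack_points_def)
  have cut: "y(Suc n := undefined) \<in> {1..n} \<rightarrow>\<^sub>E UNIV" if "y \<in> slack_points (Suc n) k" for y
    using that by (auto simp: slack_points_def PiE_def extensional_def)
  have "(\<Sum>y\<in>slack_points (Suc n) k. \<Prod>i=1..Suc n. f i (y i)) =
      (\<Sum>(x, y)\<in>Sigma {..Suc k} (\<lambda>x. slack_points n (Suc k - x)).
         f (Suc n) x * (\<Prod>i=1..n. f i (y i)))"
  proof (rule sum.reindex_bij_witness[where
        i = "\<lambda>(x, y). y(Suc n := x)" and j = "\<lambda>y. (y (Suc n), y(Suc n := undefined))"])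
    fix y assume y: "y \<in> slack_points (Suc n) k"
    show "(y (Suc n), y(Suc n := undefined)) \<in> Sigma {..Suc k} (\<lambda>x. slack_points n (Suc k - x))"
      using slack_points_Suc_iff[OF cut[OF y], of "y (Suc n)" k] y by simp
    have "(\<Prod>i=1..n. f i ((y(Suc n := undefined)) i)) = (\<Prod>i=1..n. f i (y i))"
      by (rule prod.cong) auto
    then show "(case (y (Suc n), y(Suc n := undefined)) of
        (x, y) \<Rightarrow> f (Suc n) x * (\<Prod>i=1..n. f i (y i))) = (\<Prod>i=1..Suc n. f i (y i))"
      by (simp add: mult.commute)
  next
    fix z assume z: "z \<in> Sigma {..Suc k} (\<lambda>x. slack_points n (Suc k - x))"
    then obtain x y where xy: "z = (x, y)" "x \<le> Suc k" "y \<in> slack_points n (Suc k - x)" by auto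
    have "y (Suc n) = undefined" using ext[OF xy(3)] by (auto simp: PiE_def extensional_def)
    then show "(\<lambda>y. (y (Suc n), y(Suc n := undefined))) (case z of (x, y) \<Rightarrow> y(Suc n := x)) = z"
      using xy(1) by (auto simp: fun_upd_idem)
    show "(case z of (x, y) \<Rightarrow> y(Suc n := x)) \<in> slack_points (Suc n) k"
      using slack_points_Suc_iff[OF ext[OF xy(3)], of x k] xy by simp
  qed simp
  also have "\<dots> = (\<Sum>x\<le>Suc k. f (Suc n) x * (\<Sum>y\<in>slack_points n (Suc k - x). \<Prod>i=1..n. f i (y i)))"
    by (simp add: sum.Sigma[symmetric] finite_slack_points sum_distrib_left del: sum.atMost_Suc)
  finally show ?thesis .
qed

lemma path_count_eq_sum:
  assumes "h 0 = 0" "\<And>i. i < n \<Longrightarrow> h i \<le> h (Suc i)"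
  shows "path_count (capped h n) (n + k) (h n) =
    (\<Sum>y\<in>slack_points n k. \<Prod>i=1..n. multichoose (h i - h (i - 1)) (y i))"
  using assms(2)
proof (induction n arbitrary: k)
  case 0
  then show ?case by (simp add: slack_points_0 path_count_axis assms(1))
next
  case (Suc n)
  have IH: "path_count (capped h n) (n + l) (h n) =
      (\<Sum>y\<in>slack_points n l. \<Prod>i=1..n. multichoose (h i - h (i - 1)) (y i))" for l
    using Suc by simp
  show ?case
    unfolding sum_slack_points_Suc[where f = "\<lambda>i. multichoose (h i - h (i - 1))"]
      path_count_capped_rec[OF assms(1) Suc.prems[OF lessI]] IH
    by (simp only: diff_Suc_1)
qed


section \<open>The number of lattice points\<close>

lemma card_slack_points_Suc:
  "card (slack_points (Suc n) k) = (\<Sum>j\<le>Suc k. card (slack_points n j))"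
proof -
  have "card (slack_points (Suc n) k) = (\<Sum>x\<le>Suc k. card (slack_points n (Suc k - x)))"
    using sum_slack_points_Suc[of "\<lambda>_ _. 1 :: nat" n k] by (simp del: sum.atMost_Suc)
  also have "\<dots> = (\<Sum>j\<le>Suc k. card (slack_points n j))"
    using sum.nat_diff_reindex[of "\<lambda>j. card (slack_points n j)" "Suc (Suc k)"]
    unfolding lessThan_Suc_atMost by (simp del: sum.atMost_Suc)
  finally show ?thesis .
qed

text \<open>
  The ballot numbers in the form given by the reflection principle. Consecutive instances of the
  recurrence differ by one summand, which turns it into a Pascal recurrence; at the boundary
  \<open>k = 0\<close> it is the symmetry of the binomial coefficients that makes the induction work.
\<close>

lemma card_slack_points:
  "card (slack_points (Suc n) k) + (2 * n + k + 3 choose n) = (2 * n + k + 3 choose Suc n)"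
proof (induction n arbitrary: k)
  case 0
  then show ?case by (simp add: card_slack_points_Suc slack_points_0)
next
  case (Suc n)
  note IH = Suc.IH
  show ?case
  proof (induction k)
    case 0
    have "(2 * n + 3 choose Suc (Suc n)) = (2 * n + 3 choose Suc n)"
      using binomial_symmetric[of "Suc n" "2 * n + 3"] by simp
    then show ?case
      using IH[of 0] IH[of 1]
      by (simp add: card_slack_points_Suc[of "Suc n"] eval_nat_numeral)
  next
    case (Suc k)
    have "card (slack_points (Suc (Suc n)) (Suc k)) =
        card (slack_points (Suc (Suc n)) k) + card (slack_points (Suc n) (Suc (Suc k)))"
      by (simp add: card_slack_points_Suc[of "Suc n"])
    then show ?case
      using Suc.IH IH[of "Suc (Suc k)"]
      by (simp add: eval_nat_numeral)
  qed
qed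

lemma card_slack_points_catalan: "real (card (slack_points n 0)) = catalan (n + 1)"
proof (cases n)
  case 0
  then show ?thesis by (simp add: slack_points_0 catalan_def)
next
  case (Suc k)
  define c where "c = (2 * n + 1 choose n)"
  have card: "card (slack_points n 0) + (2 * n + 1 choose k) = c"
    using card_slack_points[of k 0] by (simp add: Suc c_def eval_nat_numeral)
  \<comment> \<open>adjacent binomial coefficients: \<open>C(2n+1, n-1) / C(2n+1, n) = n / (n+2)\<close>\<close>
  have 1: "(n + 2) * (2 * n + 1 choose k) = n * c"
    using Suc_times_binomial_add[of k "k + 2"]
    by (simp add: Suc c_def mult_2 del: binomial_Suc_Suc mult_Suc)
  have "(2 * n + 1 choose Suc n) = c"
    using binomial_symmetric[of n "2 * n + 1"] by (simp add: c_def)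
  then have 2: "(2 * (n + 1) choose (n + 1)) = 2 * c" by (simp add: c_def)
  have "(n + 2) * card (slack_points n 0) + n * c = (n + 2) * c"
    using arg_cong[OF card, of "\<lambda>z. (n + 2) * z"] 1 by (simp add: algebra_simps)
  then have "(n + 2) * card (slack_points n 0) = 2 * c" by (simp add: algebra_simps)
  then have "real (n + 2) * real (card (slack_points n 0)) = real (2 * c)"
    by (metis of_nat_mult)
  then have "real (card (slack_points n 0)) = real (2 * c) / real (n + 1 + 1)"
    by (subst eq_divide_eq) (simp add: mult.commute)
  then show ?thesis unfolding catalan_def 2 .
qed

section \<open>Lattice points of the Pitman--Stanley polytope\<close>

lemma sum_initial_reversed:
  fixes f :: "nat \<Rightarrow> 'a :: comm_monoid_add"
  assumes "i \<le> n"
  shows "(\<Sum>j=1..i. f (n + 1 - j)) = (\<Sum>j=n + 1 - i..n. f j)"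
  by (rule sum.reindex_bij_witness[where i = "\<lambda>j. n + 1 - j" and j = "\<lambda>j. n + 1 - j"])
    (use assms in auto)

lemma lattice_point_floor:
  assumes "x \<in> lattice_points n (pitman_stanley n w)" "i \<in> {1..n}"
  shows "real (nat \<lfloor>x i\<rfloor>) = x i"
proof -
  have "0 \<le> x i" "x i \<in> \<int>"
    using assms by (auto simp: lattice_points_def pitman_stanley_def PiE_iff)
  then show ?thesis by (auto elim: Ints_cases)
qed

lemma lattice_point_initial:
  assumes "x \<in> lattice_points n (pitman_stanley n (\<lambda>_. 1))" "i \<in> {1..n}"
  shows "(\<Sum>j=1..i. x j) \<le> real i"
  using assms by (simp add: lattice_points_def pitman_stanley_def partial_sums_def)

lemma bij_betw_lattice_points:
  "bij_betw (\<lambda>y. \<lambda>i\<in>{1..n}. real (y (n + 1 - i))) (slack_points n 0)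
     (lattice_points n (pitman_stanley n (\<lambda>_. 1)))"
proof (rule bij_betwI[where g = "\<lambda>x. \<lambda>i\<in>{1..n}. nat \<lfloor>x (n + 1 - i)\<rfloor>"])
  show "(\<lambda>y. \<lambda>i\<in>{1..n}. real (y (n + 1 - i))) \<in>
      slack_points n 0 \<rightarrow> lattice_points n (pitman_stanley n (\<lambda>_. 1))"
  proof
    fix y assume y: "y \<in> slack_points n 0"
    have "(\<Sum>j=1..i. real (y (n + 1 - j))) \<le> real i" if i: "i \<in> {1..n}" for i
    proof -
      have i_le: "i \<le> n" and i': "n + 1 - i \<in> {1..n}" using i by auto
      have "(\<Sum>j=1..i. y (n + 1 - j)) \<le> n + 1 - (n + 1 - i)"
        unfolding sum_initial_reversed[of i n y, OF i_le]
        using slack_points_tail[OF y i'] by simp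
      also have "\<dots> = i" using i by auto
      finally show ?thesis by (metis of_nat_le_iff of_nat_sum)
    qed
    moreover have "(\<Sum>j=1..i. (\<lambda>i\<in>{1..n}. real (y (n + 1 - i))) j) = (\<Sum>j=1..i. real (y (n + 1 - j)))"
      if "i \<in> {1..n}" for i
      using that by (intro sum.cong) auto
    ultimately show "(\<lambda>i\<in>{1..n}. real (y (n + 1 - i))) \<in>
        lattice_points n (pitman_stanley n (\<lambda>_. 1))"
      by (auto simp: lattice_points_def pitman_stanley_def partial_sums_def)
  qed
  show "(\<lambda>x. \<lambda>i\<in>{1..n}. nat \<lfloor>x (n + 1 - i)\<rfloor>) \<in>
      lattice_points n (pitman_stanley n (\<lambda>_. 1)) \<rightarrow> slack_points n 0"
  proof
    fix x assume x: "x \<in> lattice_points n (pitman_stanley n (\<lambda>_. 1))"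
    have "(\<Sum>j=i..n. nat \<lfloor>x (n + 1 - j)\<rfloor>) \<le> n + 1 - i" if i: "i \<in> {1..n}" for i
    proof -
      have i': "n + 1 - i \<in> {1..n}" "n + 1 - (n + 1 - i) = i" using i by auto
      have "(\<Sum>j=i..n. nat \<lfloor>x (n + 1 - j)\<rfloor>) = (\<Sum>j=1..n + 1 - i. nat \<lfloor>x (n + 1 - (n + 1 - j))\<rfloor>)"
        using sum_initial_reversed[of "n + 1 - i" n "\<lambda>j. nat \<lfloor>x (n + 1 - j)\<rfloor>"] i' by simp
      also have "real \<dots> = (\<Sum>j=1..n + 1 - i. x j)"
        unfolding of_nat_sum
      proof (rule sum.cong[OF refl])
        fix j assume j: "j \<in> {1..n + 1 - i}"
        then have "j \<in> {1..n}" and "n + 1 - (n + 1 - j) = j" using i by auto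
        then show "real (nat \<lfloor>x (n + 1 - (n + 1 - j))\<rfloor>) = x j"
          using lattice_point_floor[OF x] by simp
      qed
      also have "\<dots> \<le> real (n + 1 - i)"
        by (rule lattice_point_initial[OF x i'(1)])
      finally show ?thesis by (simp only: of_nat_le_iff)
    qed
    moreover have "(\<Sum>j=i..n. (\<lambda>i\<in>{1..n}. nat \<lfloor>x (n + 1 - i)\<rfloor>) j) = (\<Sum>j=i..n. nat \<lfloor>x (n + 1 - j)\<rfloor>)"
      if "i \<in> {1..n}" for i
      using that by (intro sum.cong) auto
    ultimately show "(\<lambda>i\<in>{1..n}. nat \<lfloor>x (n + 1 - i)\<rfloor>) \<in> slack_points n 0"
      by (auto simp: slack_points_def)
  qed
next
  fix y assume "y \<in> slack_points n 0"
  then have "y \<in> extensional {1..n}" by (auto simp: slack_points_def PiE_def)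
  then show "(\<lambda>i\<in>{1..n}. nat \<lfloor>(\<lambda>i\<in>{1..n}. real (y (n + 1 - i))) (n + 1 - i)\<rfloor>) = y"
    by (intro extensionalityI[where A = "{1..n}"]) auto
next
  fix x assume x: "x \<in> lattice_points n (pitman_stanley n (\<lambda>_. 1))"
  show "(\<lambda>i\<in>{1..n}. real ((\<lambda>i\<in>{1..n}. nat \<lfloor>x (n + 1 - i)\<rfloor>) (n + 1 - i))) = x"
  proof (rule extensionalityI[where A = "{1..n}"])
    show "x \<in> extensional {1..n}"
      using x by (simp add: lattice_points_def pitman_stanley_def PiE_def)
    fix i assume i: "i \<in> {1..n}"
    then have "n + 1 - i \<in> {1..n}" and "n + 1 - (n + 1 - i) = i" by auto
    then show "(\<lambda>i\<in>{1..n}. real ((\<lambda>i\<in>{1..n}. nat \<lfloor>x (n + 1 - i)\<rfloor>) (n + 1 - i))) i = x i"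
      using i lattice_point_floor[OF x i] by simp
  qed simp
qed

theorem mainTheorem1:
  fixes n m :: nat and p :: "(int \<times> int) list" and v :: "nat \<Rightarrow> int"
  assumes "ne_path n m p"
    and "v = differences (height p)"
  shows "real (card (lattice_points n (pitman_stanley n (\<lambda>_. 1)))) = catalan (n + 1) \<and>
    real (LP n m p) =
      (\<Sum>x\<in>lattice_points n (pitman_stanley n (\<lambda>_. 1)).
        \<Prod>i=1..n. (real_of_int (v (n + 1 - i)) + x i - 1) gchoose (nat \<lfloor>x i\<rfloor>))"
proof -
  \<comment> \<open>the value at \<open>0\<close> makes \<open>v 1 = h 1 - h 0\<close> an ordinary difference\<close>
  define h where "h i = (if i = 0 then 0 else nat (height p i))" for i
  have h_height: "int (h i) = height p i" if "i \<in> {1..n}" for i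
    using height_range[OF assms(1) that] that by (simp add: h_def)
  have h0: "h 0 = 0" by (simp add: h_def)
  have h_mono: "h i \<le> h (Suc i)" if "i < n" for i
    using height_mono[OF assms(1), of i] that by (cases "i = 0") (simp_all add: h_def nat_mono)
  have h_le: "h n \<le> m"
    using height_range[OF assms(1), of n] by (cases "n = 0") (auto simp: h_def nat_le_iff)
  have v: "real_of_int (v i) = real (h i - h (i - 1))" if i: "i \<in> {1..n}" for i
  proof (cases "i = 1")
    case True
    then show ?thesis using h_height[OF i] assms(2) h0 by (simp add: differences_def)
  next
    case False
    then have i': "i - 1 \<in> {1..n}" using i by auto
    have "h (i - 1) \<le> h i" using h_mono[of "i - 1"] i by auto
    then have "v i = int (h i - h (i - 1))"
      using False h_height[OF i] h_height[OF i'] assms(2) by (simp add: differences_def of_nat_diff)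
    then show ?thesis by simp
  qed
  have "{q. ne_path n m q \<and> restricted_by n p q} = admissible_paths (capped h n) n m"
  proof -
    have "height q i \<le> height p i \<longleftrightarrow> nat (height q i) \<le> h i"
      if "ne_path n m q" "i \<in> {1..n}" for q i
      using height_range[OF that] h_height[OF that(2)] by linarith
    then show ?thesis by (auto simp: admissible_paths_def restricted_by_def capped_def)
  qed
  then have "LP n m p = path_count (capped h n) n (h n)"
    using card_admissible_paths path_count_capped_const_ge[of h, OF h0 h_le] by (simp add: LP_def)
  also have "\<dots> = (\<Sum>y\<in>slack_points n 0. \<Prod>i=1..n. multichoose (h i - h (i - 1)) (y i))"
    using path_count_eq_sum[of h n 0, OF h0 h_mono] by simp
  also have "real \<dots> = (\<Sum>y\<in>slack_points n 0. \<Prod>i=1..n.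
      real (multichoose (h (n + 1 - i) - h (n + 1 - i - 1)) (y (n + 1 - i))))"
    unfolding of_nat_sum of_nat_prod
    by (subst prod.atLeastAtMost_rev) simp
  also have "\<dots> = (\<Sum>y\<in>slack_points n 0. \<Prod>i=1..n.
      (real_of_int (v (n + 1 - i)) + (\<lambda>i\<in>{1..n}. real (y (n + 1 - i))) i - 1)
        gchoose (nat \<lfloor>(\<lambda>i\<in>{1..n}. real (y (n + 1 - i))) i\<rfloor>))"
    by (intro sum.cong prod.cong refl) (subst v, auto simp: multichoose_gchoose)
  also have "\<dots> = (\<Sum>x\<in>lattice_points n (pitman_stanley n (\<lambda>_. 1)).
        \<Prod>i=1..n. (real_of_int (v (n + 1 - i)) + x i - 1) gchoose (nat \<lfloor>x i\<rfloor>))"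
    by (rule sum.reindex_bij_betw[OF bij_betw_lattice_points])
  finally show ?thesis
    using bij_betw_same_card[OF bij_betw_lattice_points] card_slack_points_catalan by metis
qed

end
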